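(* Let $R$ be a commutative ring and let $X=\operatorname{Max}(R)$ with the Zariski topology. Then the Jacobson radical of $R$ is a lifting ideal of $R$ if and only if the ring map $\mathcal{B}(R)\rightarrow\operatorname{Clop}(X)$ given by $e\mapsto X\cap D(e)$ is an isomorphism.
   Context: All rings are commutative with $1$. An ideal $I$ of a ring $R$ is called a lifting ideal of $R$ if every idempotent of $R/I$ is the image of an idempotent of $R$; equivalently, whenever $f\in R$ satisfies $f-f^{2}\in I$, there exists an idempotent $e\in R$ with $f-e\in I$. $\mathcal{B}(R)=\{e\in R: e=e^{2}\}$ is the Boolean ring of $R$, with addition $e\oplus e'=e+e'-2ee'$ and multiplication $ee'$. $\operatorname{Max}(R)$ is the set of maximal ideals of $R$ with the subspace topology from $\operatorname{Spec}(R)$. For $f\in R$, $D(f)=\{\mathfrak{p}\in\operatorname{Spec}(R): f\notin\mathfrak{p}\}$. For a topological space $X$, $\operatorname{Clop}(X)$ is the set of clopen subsets of $X$, viewed as a subring of the power set ring $\mathcal{P}(X)$ (addition is symmetric difference, multiplication is intersection, unit is $X$). *)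

theory Defs
  imports "HOL-Algebra.QuotRing" "HOL-Algebra.Subrings" "HOL-Analysis.Abstract_Topology"
begin

section \<open>Idempotents, the Boolean ring of a ring, and lifting ideals\<close>

definition idempotents :: "('a, 'm) ring_scheme \<Rightarrow> 'a set" where
  "idempotents R = {e \<in> carrier R. e \<otimes>\<^bsub>R\<^esub> e = e}"

definition boolean_ring :: "('a, 'm) ring_scheme \<Rightarrow> 'a ring" where
  "boolean_ring R =
    \<lparr>carrier = idempotents R,
     mult = (\<lambda>e f. e \<otimes>\<^bsub>R\<^esub> f),
     one = \<one>\<^bsub>R\<^esub>,
     zero = \<zero>\<^bsub>R\<^esub>,
     add = (\<lambda>e f. (e \<oplus>\<^bsub>R\<^esub> f) \<ominus>\<^bsub>R\<^esub> ([(2::nat)] \<cdot>\<^bsub>R\<^esub> (e \<otimes>\<^bsub>R\<^esub> f)))\<rparr>"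

definition lifting_ideal :: "'a set \<Rightarrow> ('a, 'm) ring_scheme \<Rightarrow> bool" where
  "lifting_ideal I R \<longleftrightarrow>
    ideal I R \<and> (\<forall>x \<in> idempotents (R Quot I). \<exists>e \<in> idempotents R. x = I +>\<^bsub>R\<^esub> e)"

section \<open>Prime and maximal spectrum\<close>

definition Spec :: "('a, 'm) ring_scheme \<Rightarrow> 'a set set" where
  "Spec R = {P. primeideal P R}"

definition MaxSpec :: "('a, 'm) ring_scheme \<Rightarrow> 'a set set" where
  "MaxSpec R = {M. maximalideal M R}"

text \<open>Intersecting with the carrier matters only for the zero ring, which has no maximal ideals
  and whose Jacobson radical is the whole ring.\<close>

definition jacobson_radical :: "('a, 'm) ring_scheme \<Rightarrow> 'a set" where
  "jacobson_radical R = carrier R \<inter> \<Inter>(MaxSpec R)"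

definition basic_open :: "('a, 'm) ring_scheme \<Rightarrow> 'a \<Rightarrow> 'a set set" where
  "basic_open R f = {P \<in> Spec R. f \<notin> P}"

definition zero_locus :: "('a, 'm) ring_scheme \<Rightarrow> 'a set \<Rightarrow> 'a set set" where
  "zero_locus R E = {P \<in> Spec R. E \<subseteq> P}"

definition zariski_topology :: "('a, 'm) ring_scheme \<Rightarrow> 'a set topology" where
  "zariski_topology R = topology (\<lambda>U. \<exists>E \<subseteq> carrier R. U = Spec R - zero_locus R E)"

lemma istopology_zariski:
  fixes R :: "('a, 'm) ring_scheme"
  shows "istopology (\<lambda>U. \<exists>E \<subseteq> carrier R. U = Spec R - zero_locus R E)"
  unfolding istopology_def
proof (intro conjI allI impI)
  fix S T
  assume "\<exists>E \<subseteq> carrier R. S = Spec R - zero_locus R E"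
    and "\<exists>E \<subseteq> carrier R. T = Spec R - zero_locus R E"
  then obtain E F where E: "E \<subseteq> carrier R" "S = Spec R - zero_locus R E"
    and F: "F \<subseteq> carrier R" "T = Spec R - zero_locus R F" by blast
  define G where "G = {e \<otimes>\<^bsub>R\<^esub> f | e f. e \<in> E \<and> f \<in> F}"
  have key: "G \<subseteq> P \<longleftrightarrow> E \<subseteq> P \<or> F \<subseteq> P" if "P \<in> Spec R" for P
  proof -
    interpret primeideal P R using that by (simp add: Spec_def)
    show ?thesis
    proof
      assume "G \<subseteq> P"
      show "E \<subseteq> P \<or> F \<subseteq> P"
      proof (rule ccontr)
        assume "\<not> (E \<subseteq> P \<or> F \<subseteq> P)"
        then obtain e f where "e \<in> E" "e \<notin> P" "f \<in> F" "f \<notin> P" by blast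
        moreover from this have "e \<otimes>\<^bsub>R\<^esub> f \<in> P" using \<open>G \<subseteq> P\<close> G_def by blast
        ultimately show False using I_prime E(1) F(1) by blast
      qed
    next
      assume "E \<subseteq> P \<or> F \<subseteq> P"
      then show "G \<subseteq> P" using E(1) F(1) I_l_closed I_r_closed unfolding G_def by blast
    qed
  qed
  have "G \<subseteq> carrier R" if "Spec R \<noteq> {}"
  proof -
    from that obtain P where "primeideal P R" by (auto simp: Spec_def)
    then interpret primeideal P R .
    show ?thesis using E(1) F(1) unfolding G_def by blast
  qed
  note G = this
  have eq: "S \<inter> T = Spec R - zero_locus R G"
  proof (rule Set.set_eqI)
    fix P
    show "P \<in> S \<inter> T \<longleftrightarrow> P \<in> Spec R - zero_locus R G"
      using key[of P] unfolding E(2) F(2) zero_locus_def by simp blast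
  qed
  show "\<exists>E \<subseteq> carrier R. S \<inter> T = Spec R - zero_locus R E"
  proof (cases "Spec R = {}")
    case True
    then show ?thesis unfolding eq by (intro exI[of _ "{}"]) simp
  next
    case False
    then show ?thesis using G eq by (intro exI[of _ G]) simp
  qed
next
  fix K
  assume "\<forall>S \<in> K. \<exists>E \<subseteq> carrier R. S = Spec R - zero_locus R E"
  then obtain E where E: "\<And>S. S \<in> K \<Longrightarrow> E S \<subseteq> carrier R \<and> S = Spec R - zero_locus R (E S)"
    by metis
  have eq: "\<Union>K = Spec R - zero_locus R (\<Union>S\<in>K. E S)"
  proof (rule Set.set_eqI)
    fix P
    have "P \<in> S \<longleftrightarrow> P \<in> Spec R \<and> \<not> E S \<subseteq> P" if "S \<in> K" for S
    proof -
      have "P \<in> S \<longleftrightarrow> P \<in> Spec R - zero_locus R (E S)"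
        using E[OF that] by (rule arg_cong[OF conjunct2])
      then show ?thesis unfolding zero_locus_def by blast
    qed
    then show "P \<in> \<Union>K \<longleftrightarrow> P \<in> Spec R - zero_locus R (\<Union>S\<in>K. E S)"
      unfolding zero_locus_def by auto
  qed
  have "(\<Union>S\<in>K. E S) \<subseteq> carrier R"
    using E by (intro UN_least) simp
  with eq show "\<exists>E \<subseteq> carrier R. \<Union>K = Spec R - zero_locus R E"
    by (intro exI[of _ "\<Union>S\<in>K. E S"]) simp
qed

lemma openin_zariski_topology:
  "openin (zariski_topology R) U \<longleftrightarrow> (\<exists>E \<subseteq> carrier R. U = Spec R - zero_locus R E)"
  unfolding zariski_topology_def by (simp only: topology_inverse'[OF istopology_zariski])

definition max_topology :: "('a, 'm) ring_scheme \<Rightarrow> 'a set topology" where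
  "max_topology R = subtopology (zariski_topology R) (MaxSpec R)"

section \<open>The ring of clopen subsets\<close>

definition power_set_ring :: "'a set \<Rightarrow> 'a set ring" where
  "power_set_ring S =
    \<lparr>carrier = Pow S, mult = (\<inter>), one = S, zero = {}, add = sym_diff\<rparr>"

definition clop_ring :: "'a topology \<Rightarrow> 'a set ring" where
  "clop_ring X = (power_set_ring (topspace X))\<lparr>carrier := {U. openin X U \<and> closedin X U}\<rparr>"

section \<open>Consistency of the definitions\<close>

lemma cring_boolean_ring:
  assumes "cring R"
  shows "cring (boolean_ring R)"
proof -
  interpret cring R by fact
  let ?a = "\<lambda>e f. (e \<oplus>\<^bsub>R\<^esub> f) \<ominus>\<^bsub>R\<^esub> ([(2::nat)] \<cdot>\<^bsub>R\<^esub> (e \<otimes>\<^bsub>R\<^esub> f))"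
  have two: "[(2::nat)] \<cdot>\<^bsub>R\<^esub> x = x \<oplus>\<^bsub>R\<^esub> x" if "x \<in> carrier R" for x
    using that by (simp add: numeral_2_eq_2)
  have a_closed: "?a e f \<in> idempotents R" if "e \<in> idempotents R" "f \<in> idempotents R" for e f
  proof -
    have c: "e \<in> carrier R" "f \<in> carrier R" "e \<otimes>\<^bsub>R\<^esub> e = e" "f \<otimes>\<^bsub>R\<^esub> f = f"
      using that by (auto simp: idempotents_def)
    define u where "u = e \<otimes>\<^bsub>R\<^esub> f"
    have u: "u \<in> carrier R" "e \<otimes>\<^bsub>R\<^esub> u = u" "f \<otimes>\<^bsub>R\<^esub> u = u" "u \<otimes>\<^bsub>R\<^esub> u = u" "e \<otimes>\<^bsub>R\<^esub> f = u"
      using c unfolding u_def by (simp_all add: m_ac) (metis m_assoc m_lcomm)+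
    define d where "d = e \<ominus>\<^bsub>R\<^esub> u"
    define d' where "d' = f \<ominus>\<^bsub>R\<^esub> u"
    have d: "d \<in> carrier R" "d' \<in> carrier R" using c u by (auto simp: d_def d'_def)
    have dd: "d \<otimes>\<^bsub>R\<^esub> d = (e \<otimes>\<^bsub>R\<^esub> e \<ominus>\<^bsub>R\<^esub> e \<otimes>\<^bsub>R\<^esub> u) \<ominus>\<^bsub>R\<^esub> (e \<otimes>\<^bsub>R\<^esub> u \<ominus>\<^bsub>R\<^esub> u \<otimes>\<^bsub>R\<^esub> u)"
      "d' \<otimes>\<^bsub>R\<^esub> d' = (f \<otimes>\<^bsub>R\<^esub> f \<ominus>\<^bsub>R\<^esub> f \<otimes>\<^bsub>R\<^esub> u) \<ominus>\<^bsub>R\<^esub> (f \<otimes>\<^bsub>R\<^esub> u \<ominus>\<^bsub>R\<^esub> u \<otimes>\<^bsub>R\<^esub> u)"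
      "d \<otimes>\<^bsub>R\<^esub> d' = (e \<otimes>\<^bsub>R\<^esub> f \<ominus>\<^bsub>R\<^esub> e \<otimes>\<^bsub>R\<^esub> u) \<ominus>\<^bsub>R\<^esub> (f \<otimes>\<^bsub>R\<^esub> u \<ominus>\<^bsub>R\<^esub> u \<otimes>\<^bsub>R\<^esub> u)"
      unfolding d_def d'_def using c(1,2) u(1) by algebra+
    have zero: "d \<otimes>\<^bsub>R\<^esub> d' = \<zero>\<^bsub>R\<^esub>" unfolding dd(3) u(2-5) using u(1) by algebra
    have dd1: "d \<otimes>\<^bsub>R\<^esub> d = d" unfolding dd(1) u(2-5) c(3) d_def using c u by algebra
    have dd2: "d' \<otimes>\<^bsub>R\<^esub> d' = d'" unfolding dd(2) u(2-5) c(4) d'_def using c u by algebra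
    have s: "?a e f = d \<oplus>\<^bsub>R\<^esub> d'"
      unfolding u(5) two[OF u(1)] d_def d'_def using c(1,2) u(1) by algebra
    have "(d \<oplus>\<^bsub>R\<^esub> d') \<otimes>\<^bsub>R\<^esub> (d \<oplus>\<^bsub>R\<^esub> d') = d \<otimes>\<^bsub>R\<^esub> d \<oplus>\<^bsub>R\<^esub> d' \<otimes>\<^bsub>R\<^esub> d' \<oplus>\<^bsub>R\<^esub> (d \<otimes>\<^bsub>R\<^esub> d' \<oplus>\<^bsub>R\<^esub> d \<otimes>\<^bsub>R\<^esub> d')"
      using d by algebra
    also have "\<dots> = d \<oplus>\<^bsub>R\<^esub> d'" unfolding zero dd1 dd2 using d by algebra
    finally have "?a e f \<otimes>\<^bsub>R\<^esub> ?a e f = ?a e f" unfolding s .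
    with c show ?thesis by (simp add: idempotents_def)
  qed
  have m_closed': "e \<otimes>\<^bsub>R\<^esub> f \<in> idempotents R" if "e \<in> idempotents R" "f \<in> idempotents R" for e f
  proof -
    have c: "e \<in> carrier R" "f \<in> carrier R" "e \<otimes>\<^bsub>R\<^esub> e = e" "f \<otimes>\<^bsub>R\<^esub> f = f"
      using that by (auto simp: idempotents_def)
    have "(e \<otimes>\<^bsub>R\<^esub> f) \<otimes>\<^bsub>R\<^esub> (e \<otimes>\<^bsub>R\<^esub> f) = e \<otimes>\<^bsub>R\<^esub> f"
      using c by (simp add: m_ac) (metis m_assoc)
    with c show ?thesis by (simp add: idempotents_def)
  qed
  have idc: "e \<in> carrier R" "e \<otimes>\<^bsub>R\<^esub> e = e" if "e \<in> idempotents R" for e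
    using that by (auto simp: idempotents_def)
  have z: "\<zero>\<^bsub>R\<^esub> \<in> idempotents R" and o: "\<one>\<^bsub>R\<^esub> \<in> idempotents R"
    by (auto simp: idempotents_def)
  have ac: "?a e f = e \<oplus>\<^bsub>R\<^esub> f \<ominus>\<^bsub>R\<^esub> (e \<otimes>\<^bsub>R\<^esub> f \<oplus>\<^bsub>R\<^esub> e \<otimes>\<^bsub>R\<^esub> f)"
    if "e \<in> carrier R" "f \<in> carrier R" for e f
    using that by (simp add: two)
  show ?thesis
  proof (intro cringI abelian_groupI comm_monoidI;
      unfold boolean_ring_def ring.simps monoid.simps partial_object.simps)
    fix x y z assume xyz: "x \<in> idempotents R" "y \<in> idempotents R" "z \<in> idempotents R"
    note c = idc(1)[OF xyz(1)] idc(1)[OF xyz(2)] idc(1)[OF xyz(3)]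
    define p q r t where "p = x \<otimes>\<^bsub>R\<^esub> y" and "q = x \<otimes>\<^bsub>R\<^esub> z" and "r = y \<otimes>\<^bsub>R\<^esub> z" and "t = p \<otimes>\<^bsub>R\<^esub> z"
    note defs = this
    have d: "p \<in> carrier R" "q \<in> carrier R" "r \<in> carrier R" "t \<in> carrier R"
      using c by (auto simp: defs)
    have xr: "x \<otimes>\<^bsub>R\<^esub> r = t" and qr: "q \<otimes>\<^bsub>R\<^esub> r = t"
      using c idc(2)[OF xyz(3)] unfolding defs by (simp_all add: m_ac)
    have xy: "?a x y = x \<oplus>\<^bsub>R\<^esub> y \<ominus>\<^bsub>R\<^esub> (p \<oplus>\<^bsub>R\<^esub> p)" and yz: "?a y z = y \<oplus>\<^bsub>R\<^esub> z \<ominus>\<^bsub>R\<^esub> (r \<oplus>\<^bsub>R\<^esub> r)"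
      using ac[OF c(1,2)] ac[OF c(2,3)] by (simp_all add: defs)
    have cl: "?a x y \<in> carrier R" "?a y z \<in> carrier R" using c by auto
    have e1: "?a x y \<otimes>\<^bsub>R\<^esub> z = q \<oplus>\<^bsub>R\<^esub> r \<ominus>\<^bsub>R\<^esub> (t \<oplus>\<^bsub>R\<^esub> t)"
      unfolding xy unfolding defs using c by algebra
    have e2: "x \<otimes>\<^bsub>R\<^esub> ?a y z = p \<oplus>\<^bsub>R\<^esub> q \<ominus>\<^bsub>R\<^esub> (x \<otimes>\<^bsub>R\<^esub> r \<oplus>\<^bsub>R\<^esub> x \<otimes>\<^bsub>R\<^esub> r)"
      unfolding yz p_def q_def using c d by algebra
    have w: "q \<oplus>\<^bsub>R\<^esub> r \<ominus>\<^bsub>R\<^esub> (t \<oplus>\<^bsub>R\<^esub> t) \<in> carrier R" "p \<oplus>\<^bsub>R\<^esub> q \<ominus>\<^bsub>R\<^esub> (t \<oplus>\<^bsub>R\<^esub> t) \<in> carrier R"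
      using d by auto
    have dbl: "(u \<oplus>\<^bsub>R\<^esub> v \<ominus>\<^bsub>R\<^esub> s) \<oplus>\<^bsub>R\<^esub> (u \<oplus>\<^bsub>R\<^esub> v \<ominus>\<^bsub>R\<^esub> s) = (u \<oplus>\<^bsub>R\<^esub> u) \<oplus>\<^bsub>R\<^esub> ((v \<oplus>\<^bsub>R\<^esub> v) \<ominus>\<^bsub>R\<^esub> (s \<oplus>\<^bsub>R\<^esub> s))"
      if "u \<in> carrier R" "v \<in> carrier R" "s \<in> carrier R" for u v s
      using that by algebra
    have lin: "(x \<oplus>\<^bsub>R\<^esub> y \<ominus>\<^bsub>R\<^esub> p') \<oplus>\<^bsub>R\<^esub> z \<ominus>\<^bsub>R\<^esub> (r' \<oplus>\<^bsub>R\<^esub> s) = x \<oplus>\<^bsub>R\<^esub> (y \<oplus>\<^bsub>R\<^esub> z \<ominus>\<^bsub>R\<^esub> r') \<ominus>\<^bsub>R\<^esub> (p' \<oplus>\<^bsub>R\<^esub> s)"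
      if "p' \<in> carrier R" "r' \<in> carrier R" "s \<in> carrier R" for p' r' s
      using that c by algebra
    have "?a (?a x y) z = (x \<oplus>\<^bsub>R\<^esub> y \<ominus>\<^bsub>R\<^esub> (p \<oplus>\<^bsub>R\<^esub> p)) \<oplus>\<^bsub>R\<^esub> z \<ominus>\<^bsub>R\<^esub> ((r \<oplus>\<^bsub>R\<^esub> r) \<oplus>\<^bsub>R\<^esub> ((q \<oplus>\<^bsub>R\<^esub> q) \<ominus>\<^bsub>R\<^esub> ((t \<oplus>\<^bsub>R\<^esub> t) \<oplus>\<^bsub>R\<^esub> (t \<oplus>\<^bsub>R\<^esub> t))))"
      unfolding e1 two[OF w(1)] unfolding xy using dbl[OF d(3,2), of "t \<oplus>\<^bsub>R\<^esub> t"] d by (simp add: a_comm)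
    also have "\<dots> = x \<oplus>\<^bsub>R\<^esub> (y \<oplus>\<^bsub>R\<^esub> z \<ominus>\<^bsub>R\<^esub> (r \<oplus>\<^bsub>R\<^esub> r)) \<ominus>\<^bsub>R\<^esub> ((p \<oplus>\<^bsub>R\<^esub> p) \<oplus>\<^bsub>R\<^esub> ((q \<oplus>\<^bsub>R\<^esub> q) \<ominus>\<^bsub>R\<^esub> ((t \<oplus>\<^bsub>R\<^esub> t) \<oplus>\<^bsub>R\<^esub> (t \<oplus>\<^bsub>R\<^esub> t))))"
      using d by (intro lin) auto
    also have "\<dots> = ?a x (?a y z)"
      unfolding e2 xr two[OF w(2)] unfolding yz using dbl[OF d(1,2), of "t \<oplus>\<^bsub>R\<^esub> t"] d by simp
    finally show "?a (?a x y) z = ?a x (?a y z)" .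
    show "?a x y \<otimes>\<^bsub>R\<^esub> z = ?a (x \<otimes>\<^bsub>R\<^esub> z) (y \<otimes>\<^bsub>R\<^esub> z)"
      unfolding e1 ac[OF m_closed[OF c(1,3)] m_closed[OF c(2,3)]]
      by (simp add: q_def[symmetric] r_def[symmetric] qr)
  next
    fix x assume x: "x \<in> idempotents R"
    have "?a x x = \<zero>\<^bsub>R\<^esub>"
      unfolding idc(2)[OF x] two[OF idc(1)[OF x]] using idc(1)[OF x] by algebra
    with x show "\<exists>y\<in>idempotents R. ?a y x = \<zero>\<^bsub>R\<^esub>" by blast
  qed (use a_closed m_closed' z o in \<open>simp_all add: idc two a_comm m_ac minus_eq\<close>)
qed

lemma cring_power_set_ring: "cring (power_set_ring S)"
proof (intro cringI abelian_groupI comm_monoidI;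
      unfold power_set_ring_def ring.simps monoid.simps partial_object.simps)
  fix x assume "x \<in> Pow S"
  then show "\<exists>y\<in>Pow S. sym_diff y x = {}" by auto
qed auto

lemma subcring_clop_ring:
  "subcring (carrier (clop_ring X)) (power_set_ring (topspace X))"
proof -
  interpret cring "power_set_ring (topspace X)" by (rule cring_power_set_ring)
  have inv: "\<ominus>\<^bsub>power_set_ring (topspace X)\<^esub> U = U" if "U \<subseteq> topspace X" for U
    by (rule minus_equality) (use that in \<open>auto simp: power_set_ring_def\<close>)
  have "subring (carrier (clop_ring X)) (power_set_ring (topspace X))"
    by (rule subringI) (auto simp: clop_ring_def inv openin_subset,
        auto simp: power_set_ring_def openin_subset dest: openin_subset)
  then show ?thesis
    by (rule subcringI'[OF _])
qed

lemma MaxSpec_subset_Spec: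
  assumes "cring R"
  shows "MaxSpec R \<subseteq> Spec R"
  using cring.maximalideal_prime[OF assms] by (auto simp: MaxSpec_def Spec_def)

lemma topspace_max_topology:
  assumes "cring R"
  shows "topspace (max_topology R) = MaxSpec R"
proof -
  interpret cring R by fact
  have "\<one>\<^bsub>R\<^esub> \<notin> P" if "P \<in> Spec R" for P
    using that primeideal.I_notcarr ideal.one_imp_carrier primeideal.axioms(1)
    unfolding Spec_def by blast
  then have "Spec R = Spec R - zero_locus R {\<one>\<^bsub>R\<^esub>}"
    by (auto simp: zero_locus_def)
  then have "openin (zariski_topology R) (Spec R)"
    unfolding openin_zariski_topology by (intro exI[of _ "{\<one>\<^bsub>R\<^esub>}"]) auto
  then have "Spec R \<subseteq> topspace (zariski_topology R)"
    by (rule openin_subset)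
  then show ?thesis
    using MaxSpec_subset_Spec[OF assms] unfolding max_topology_def topspace_subtopology by blast
qed

end

theory Submission
  imports Defs "HOL-Algebra.Ring_Divisibility"
begin

text \<open>Let \<open>J\<close> be the Jacobson radical and \<open>X\<close> the maximal spectrum. Without any hypothesis on \<open>R\<close>,
  the clopen subsets of \<open>X\<close> are exactly the sets \<open>X \<inter> D(a)\<close> with \<open>a (1 - a) \<in> J\<close>, and two such
  elements give the same set iff they differ by an element of \<open>J\<close>: the idempotents of \<open>R/J\<close>
  correspond to the clopen subsets of \<open>X\<close>. Since \<open>J\<close> contains no nonzero idempotent, distinct
  idempotents of \<open>R\<close> give distinct clopen sets. So the map in question is always an injective ring
  homomorphism, and its surjectivity says that every idempotent of \<open>R/J\<close> lifts.\<close>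

section \<open>Existence of maximal ideals\<close>

text \<open>Zorn's lemma is applied to the proper ideals containing \<open>I\<close>. The union of a
  chain stays proper because no member contains \<open>\<one>\<close>.\<close>

lemma (in cring) exists_maximalideal:
  assumes "ideal I R" "I \<noteq> carrier R"
  obtains M where "maximalideal M R" "I \<subseteq> M"
proof -
  define A where "A = {K. ideal K R \<and> I \<subseteq> K \<and> K \<noteq> carrier R}"
  have "\<exists>M\<in>A. \<forall>K\<in>A. M \<subseteq> K \<longrightarrow> K = M"
  proof (rule subset_Zorn_nonempty)
    show "A \<noteq> {}" using assms by (auto simp: A_def)
  next
    fix C assume C: "C \<noteq> {}" "subset.chain A C"
    then have CA: "C \<subseteq> A" and "subset.chain {K. ideal K R} C"
      by (auto simp: A_def pred_on.chain_def)
    then have "ideal (\<Union>C) R"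
      using chain_Union_is_ideal[of C] C(1) by simp
    moreover have "I \<subseteq> \<Union>C"
      using CA C(1) by (auto simp: A_def)
    moreover have "\<one> \<notin> K" if "K \<in> C" for K
      using CA that ideal.one_imp_carrier by (auto simp: A_def)
    then have "\<Union>C \<noteq> carrier R" by auto
    ultimately show "\<Union>C \<in> A" by (simp add: A_def)
  qed
  then obtain M where M: "M \<in> A" "\<And>K. K \<in> A \<Longrightarrow> M \<subseteq> K \<Longrightarrow> K = M" by blast
  have "maximalideal M R"
  proof (rule maximalidealI)
    show "ideal M R" "carrier R \<noteq> M" using M(1) by (auto simp: A_def)
  next
    fix K assume "ideal K R" "M \<subseteq> K" "K \<subseteq> carrier R"
    then show "K = M \<or> K = carrier R"
      using M(1) M(2)[of K] unfolding A_def by blast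
  qed
  with M(1) show ?thesis by (intro that[of M]) (auto simp: A_def)
qed

section \<open>Maximal ideals, the Jacobson radical and idempotents\<close>

abbreviation max_basic_open :: "('a, 'm) ring_scheme \<Rightarrow> 'a \<Rightarrow> 'a set set" where
  "max_basic_open R f \<equiv> MaxSpec R \<inter> basic_open R f"

lemma (in cring) mem_max_basic_open:
  "M \<in> max_basic_open R f \<longleftrightarrow> M \<in> MaxSpec R \<and> f \<notin> M"
  using MaxSpec_subset_Spec[OF is_cring] by (auto simp: basic_open_def)

lemma (in cring) MaxSpecD:
  assumes "M \<in> MaxSpec R"
  shows "ideal M R" "primeideal M R" "\<one> \<notin> M"
proof -
  show "primeideal M R"
    using assms maximalideal_prime by (simp add: MaxSpec_def)
  then interpret primeideal M R .
  show "ideal M R" by (rule is_ideal)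
  show "\<one> \<notin> M" using I_notcarr one_imp_carrier by blast
qed

lemma (in cring) ideal_jacobson_radical: "ideal (jacobson_radical R) R"
\<comment> \<open>Intersecting a family of ideals requires the family to be nonempty; with no
  maximal ideals the radical is the whole carrier.\<close>
proof (cases "MaxSpec R = {}")
  case True
  then show ?thesis by (simp add: jacobson_radical_def oneideal)
next
  case False
  then show ?thesis
    unfolding jacobson_radical_def
    by (intro i_intersect oneideal i_Intersect) (auto dest: MaxSpecD)
qed

text \<open>The image of \<open>a\<close> in the field of residues modulo \<open>M\<close> is 0 or
  1. Both memberships together would put the sum \<open>\<one>\<close> into \<open>M\<close>, and
  primality rules out that both fail.\<close>

lemma (in cring) complement_mem_iff:
  assumes "a \<in> carrier R" "a \<otimes> (\<one> \<ominus> a) \<in> M" "M \<in> MaxSpec R"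
  shows "\<one> \<ominus> a \<in> M \<longleftrightarrow> a \<notin> M"
proof -
  interpret primeideal M R using assms(3) by (rule MaxSpecD)
  have "\<one> = a \<oplus> (\<one> \<ominus> a)" using assms(1) by algebra
  then have "\<not> (a \<in> M \<and> \<one> \<ominus> a \<in> M)"
    using a_closed MaxSpecD(3)[OF assms(3)] by metis
  moreover have "a \<in> M \<or> \<one> \<ominus> a \<in> M"
    using I_prime assms(1,2) by simp
  ultimately show ?thesis by blast
qed

lemma (in cring) idempotent_complement:
  assumes "e \<in> idempotents R"
  shows "e \<in> carrier R" "e \<otimes> (\<one> \<ominus> e) = \<zero>"
proof -
  show e: "e \<in> carrier R" using assms by (simp add: idempotents_def)
  have "e \<otimes> (\<one> \<ominus> e) = e \<ominus> e \<otimes> e" using e by algebra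
  then show "e \<otimes> (\<one> \<ominus> e) = \<zero>"
    using assms e by (simp add: idempotents_def minus_eq r_neg)
qed

lemma (in cring) idempotent_complement_jacobson_radical:
  assumes "e \<in> idempotents R"
  shows "e \<otimes> (\<one> \<ominus> e) \<in> jacobson_radical R"
  using idempotent_complement[OF assms] ideal_jacobson_radical
  by (simp add: additive_subgroup.zero_closed ideal.axioms(1))

text \<open>Since \<open>e\<close> lies in every maximal ideal, \<open>\<one> \<ominus> e\<close>
  lies in none and is therefore a unit. A unit that annihilates \<open>e\<close> forces
  \<open>e\<close> to vanish.\<close>

lemma (in cring) idempotent_in_jacobson_radical:
  assumes "e \<in> idempotents R" "e \<in> jacobson_radical R"
  shows "e = \<zero>"
proof -
  note e = idempotent_complement[OF assms(1)]
  have c: "\<one> \<ominus> e \<in> carrier R" using e(1) by simp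
  have "PIdl (\<one> \<ominus> e) = carrier R"
  proof (rule ccontr)
    assume "PIdl (\<one> \<ominus> e) \<noteq> carrier R"
    then obtain M where M: "maximalideal M R" "PIdl (\<one> \<ominus> e) \<subseteq> M"
      using exists_maximalideal cgenideal_ideal[OF c] by blast
    then have MX: "M \<in> MaxSpec R" by (simp add: MaxSpec_def)
    have "e \<otimes> (\<one> \<ominus> e) \<in> M"
      using e(2) MaxSpecD(1)[OF MX] by (simp add: additive_subgroup.zero_closed ideal.axioms(1))
    moreover have "e \<in> M" using assms(2) MX by (auto simp: jacobson_radical_def)
    moreover have "\<one> \<ominus> e \<in> M" using M(2) cgenideal_self[OF c] by blast
    ultimately show False using complement_mem_iff[OF e(1) _ MX] by blast
  qed
  then obtain x where x: "x \<in> carrier R" "\<one> = x \<otimes> (\<one> \<ominus> e)"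
    unfolding cgenideal_def using one_closed by blast
  have "e = e \<otimes> (x \<otimes> (\<one> \<ominus> e))" using e(1) by (simp flip: x(2))
  also have "\<dots> = x \<otimes> (e \<otimes> (\<one> \<ominus> e))" using e(1) x(1) c by (simp add: m_lcomm)
  also have "\<dots> = \<zero>" using e(2) x(1) by simp
  finally show ?thesis .
qed

section \<open>Clopen subsets of the maximal spectrum\<close>

lemma (in cring) openin_max_topology:
  "openin (max_topology R) U \<longleftrightarrow> (\<exists>E \<subseteq> carrier R. U = {M \<in> MaxSpec R. \<not> E \<subseteq> M})"
proof -
  have "(Spec R - zero_locus R E) \<inter> MaxSpec R = {M \<in> MaxSpec R. \<not> E \<subseteq> M}" for E
    using MaxSpec_subset_Spec[OF is_cring] by (auto simp: zero_locus_def)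
  then show ?thesis
    unfolding max_topology_def openin_subtopology openin_zariski_topology by metis
qed

text \<open>This symmetric form lets a clopen set and its complement both be described by subsets of
  the ring.\<close>

lemma (in cring) mem_carrier_clop_ring:
  "U \<in> carrier (clop_ring (max_topology R)) \<longleftrightarrow>
    openin (max_topology R) U \<and> openin (max_topology R) (MaxSpec R - U)"
  using openin_subset[of "max_topology R" U]
  by (auto simp: clop_ring_def closedin_def topspace_max_topology[OF is_cring])

lemma (in cring) openin_max_basic_open:
  assumes "a \<in> carrier R"
  shows "openin (max_topology R) (max_basic_open R a)"
  unfolding openin_max_topology
  using assms by (intro exI[of _ "{a}"]) (simp add: set_eq_iff mem_max_basic_open del: Int_iff)

lemma (in cring) max_basic_open_complement:
  assumes "a \<in> carrier R" "a \<otimes> (\<one> \<ominus> a) \<in> jacobson_radical R"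
  shows "max_basic_open R (\<one> \<ominus> a) = MaxSpec R - max_basic_open R a"
proof (rule Set.set_eqI)
  fix M
  have "\<one> \<ominus> a \<in> M \<longleftrightarrow> a \<notin> M" if "M \<in> MaxSpec R"
    using complement_mem_iff[OF assms(1) _ that] assms(2) that
    by (auto simp: jacobson_radical_def)
  then show "M \<in> max_basic_open R (\<one> \<ominus> a) \<longleftrightarrow> M \<in> MaxSpec R - max_basic_open R a"
    unfolding Diff_iff mem_max_basic_open by blast
qed

text \<open>The complement is the basic open set of \<open>\<one> \<ominus> a\<close>, hence open as
  well.\<close>

lemma (in cring) max_basic_open_clopen:
  assumes "a \<in> carrier R" "a \<otimes> (\<one> \<ominus> a) \<in> jacobson_radical R"
  shows "max_basic_open R a \<in> carrier (clop_ring (max_topology R))"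
  unfolding mem_carrier_clop_ring max_basic_open_complement[OF assms, symmetric]
  using assms(1) by (intro conjI openin_max_basic_open) simp_all

text \<open>If \<open>U\<close> and its complement are the nonvanishing loci of \<open>E\<close> and \<open>F\<close>, then \<open>E\<close> and \<open>F\<close>
  generate the unit ideal, and a decomposition \<open>1 = a + b\<close> with \<open>a \<in> (E)\<close> and \<open>b \<in> (F)\<close>
  yields \<open>U = X \<inter> D(a)\<close>.\<close>

lemma (in cring) clopen_eq_max_basic_open:
  assumes "U \<in> carrier (clop_ring (max_topology R))"
  obtains a where "a \<in> carrier R" "a \<otimes> (\<one> \<ominus> a) \<in> jacobson_radical R" "U = max_basic_open R a"
proof -
  obtain E F where E: "E \<subseteq> carrier R" "U = {M \<in> MaxSpec R. \<not> E \<subseteq> M}"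
    and F: "F \<subseteq> carrier R" "MaxSpec R - U = {M \<in> MaxSpec R. \<not> F \<subseteq> M}"
    using assms unfolding mem_carrier_clop_ring openin_max_topology by blast
  note idl = genideal_ideal[OF E(1)] genideal_ideal[OF F(1)]
  \<comment> \<open>A maximal ideal above the sum would contain both \<open>E\<close> and
    \<open>F\<close>, so it would lie neither in \<open>U\<close> nor in its complement.\<close>
  have "set_add R (Idl E) (Idl F) = carrier R"
  proof (rule ccontr)
    assume "set_add R (Idl E) (Idl F) \<noteq> carrier R"
    then obtain M where M: "maximalideal M R" "set_add R (Idl E) (Idl F) \<subseteq> M"
      using exists_maximalideal add_ideals[OF idl] by blast
    have zero: "\<zero> \<in> Idl E" "\<zero> \<in> Idl F"
      using idl by (simp_all add: additive_subgroup.zero_closed ideal.axioms(1))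
    have add: "x \<oplus> y \<in> set_add R (Idl E) (Idl F)" if "x \<in> Idl E" "y \<in> Idl F" for x y
      using that unfolding set_add_def' by blast
    have "x \<in> set_add R (Idl E) (Idl F)" if "x \<in> Idl E" for x
      using add[OF that zero(2)] ideal.Icarr[OF idl(1) that] by simp
    moreover have "x \<in> set_add R (Idl E) (Idl F)" if "x \<in> Idl F" for x
      using add[OF zero(1) that] ideal.Icarr[OF idl(2) that] by simp
    ultimately have "E \<subseteq> M" "F \<subseteq> M"
      using M(2) genideal_self[OF E(1)] genideal_self[OF F(1)] by blast+
    then show False using M(1) E(2) F(2) by (auto simp: MaxSpec_def)
  qed
  then have "\<one> \<in> set_add R (Idl E) (Idl F)" by simp
  then obtain a b where a: "a \<in> Idl E" and b: "b \<in> Idl F" and ab: "\<one> = a \<oplus> b"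
    unfolding set_add_def' by blast
  have c: "a \<in> carrier R" "b \<in> carrier R"
    using a b ideal.Icarr[OF idl(1)] ideal.Icarr[OF idl(2)] by auto
  have b_eq: "\<one> \<ominus> a = b" unfolding ab using c by algebra
  \<comment> \<open>Maximal ideals outside \<open>U\<close> contain \<open>E\<close>, hence
    \<open>a\<close>; those in \<open>U\<close> contain \<open>F\<close>, hence \<open>b\<close>. So
    the product of \<open>a\<close> and \<open>b\<close> lies in all of them.\<close>
  have aM: "a \<in> M" if "M \<in> MaxSpec R" "M \<notin> U" for M
    using genideal_minimal[OF MaxSpecD(1)[OF that(1)]] that E(2) a by blast
  have bM: "b \<in> M" if "M \<in> MaxSpec R" "M \<in> U" for M
    using genideal_minimal[OF MaxSpecD(1)[OF that(1)]] that F(2) b by blast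
  have abM: "a \<otimes> (\<one> \<ominus> a) \<in> M" if "M \<in> MaxSpec R" for M
    unfolding b_eq using aM[OF that] bM[OF that] c MaxSpecD(1)[OF that]
    by (metis ideal.I_l_closed ideal.I_r_closed)
  show ?thesis
  proof (rule that)
    show "a \<in> carrier R" by (rule c)
    show "a \<otimes> (\<one> \<ominus> a) \<in> jacobson_radical R"
      using abM c by (simp add: jacobson_radical_def)
    show "U = max_basic_open R a"
    proof (rule Set.set_eqI)
      fix M
      have "M \<in> U \<longleftrightarrow> a \<notin> M" if "M \<in> MaxSpec R"
        using aM[OF that] bM[OF that] complement_mem_iff[OF c(1) abM[OF that] that] b_eq by blast
      then show "M \<in> U \<longleftrightarrow> M \<in> max_basic_open R a"
        using E(2) unfolding mem_max_basic_open by blast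
    qed
  qed
qed

text \<open>Modulo each maximal ideal both elements are 0 or 1, so their difference vanishes there
  exactly when they vanish together or not at all.\<close>

lemma (in cring) max_basic_open_eq_iff:
  assumes "a \<in> carrier R" "a \<otimes> (\<one> \<ominus> a) \<in> jacobson_radical R"
    and "b \<in> carrier R" "b \<otimes> (\<one> \<ominus> b) \<in> jacobson_radical R"
  shows "max_basic_open R a = max_basic_open R b \<longleftrightarrow> a \<ominus> b \<in> jacobson_radical R"
proof -
  have *: "a \<ominus> b \<in> M \<longleftrightarrow> (a \<in> M \<longleftrightarrow> b \<in> M)" if M: "M \<in> MaxSpec R" for M
  proof -
    interpret ideal M R using M by (rule MaxSpecD)
    have compl: "\<one> \<ominus> a \<in> M \<longleftrightarrow> a \<notin> M" "\<one> \<ominus> b \<in> M \<longleftrightarrow> b \<notin> M"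
      using complement_mem_iff[OF _ _ M] assms M by (auto simp: jacobson_radical_def)
    have sub: "x \<ominus> y \<in> M" if "x \<in> M" "y \<in> M" for x y
      using that by (simp add: minus_eq)
    \<comment> \<open>The third identity serves the case where \<open>M\<close> contains neither
      element: it then contains both complements, whose difference is
      \<open>a \<ominus> b\<close>.\<close>
    have eqs: "(a \<ominus> b) \<oplus> b = a" "a \<ominus> (a \<ominus> b) = b" "(\<one> \<ominus> b) \<ominus> (\<one> \<ominus> a) = a \<ominus> b"
      using assms(1,3) by algebra+
    show ?thesis
    proof
      assume ab: "a \<ominus> b \<in> M"
      show "a \<in> M \<longleftrightarrow> b \<in> M"
        using a_closed[OF ab, of b] sub[OF _ ab, of a] unfolding eqs by blast
    next
      assume "a \<in> M \<longleftrightarrow> b \<in> M"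
      then show "a \<ominus> b \<in> M"
        using compl sub[of a b] sub[of "\<one> \<ominus> b" "\<one> \<ominus> a"] unfolding eqs by blast
    qed
  qed
  have "max_basic_open R a = max_basic_open R b \<longleftrightarrow> (\<forall>M\<in>MaxSpec R. a \<in> M \<longleftrightarrow> b \<in> M)"
    unfolding set_eq_iff mem_max_basic_open by blast
  also have "\<dots> \<longleftrightarrow> a \<ominus> b \<in> jacobson_radical R"
    using * assms(1,3) by (simp add: jacobson_radical_def)
  finally show ?thesis .
qed

text \<open>This turns idempotency of a coset into the same membership condition that describes
  clopen sets.\<close>

lemma (in cring) idempotents_Quot_iff:
  assumes "ideal I R" "f \<in> carrier R"
  shows "I +> f \<in> idempotents (R Quot I) \<longleftrightarrow> f \<otimes> (\<one> \<ominus> f) \<in> I"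
proof -
  interpret ideal I R by fact
  have "I +> f \<in> carrier (R Quot I)"
    using assms(2) by (simp add: FactRing_def a_rcosetsI[OF a_subset])
  moreover have "(I +> f) \<otimes>\<^bsub>R Quot I\<^esub> (I +> f) = I +> f \<otimes> f"
    using assms(2) by (simp add: FactRing_def rcoset_mult_add)
  ultimately have "I +> f \<in> idempotents (R Quot I) \<longleftrightarrow> I +> f = I +> f \<otimes> f"
    by (auto simp: idempotents_def)
  also have "\<dots> \<longleftrightarrow> f \<ominus> f \<otimes> f \<in> I"
    using quotient_eq_iff_same_a_r_cos[OF assms] assms(2) by simp
  also have "f \<ominus> f \<otimes> f = f \<otimes> (\<one> \<ominus> f)"
    using assms(2) by algebra
  finally show ?thesis .
qed

section \<open>The map from idempotents to clopen sets is an injective homomorphism\<close>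

lemma (in cring) max_basic_open_hom:
  "max_basic_open R \<in> ring_hom (boolean_ring R) (clop_ring (max_topology R))"
proof (rule ring_hom_memI)
  fix e assume "e \<in> carrier (boolean_ring R)"
  then have "e \<in> idempotents R" by (simp add: boolean_ring_def)
  then show "max_basic_open R e \<in> carrier (clop_ring (max_topology R))"
    by (intro max_basic_open_clopen idempotent_complement_jacobson_radical)
      (simp_all add: idempotents_def)
next
  show "max_basic_open R \<one>\<^bsub>boolean_ring R\<^esub> = \<one>\<^bsub>clop_ring (max_topology R)\<^esub>"
    unfolding set_eq_iff mem_max_basic_open
    using MaxSpecD(3)
    by (auto simp: boolean_ring_def clop_ring_def power_set_ring_def
        topspace_max_topology[OF is_cring] mem_max_basic_open)
next
  fix e f assume ef: "e \<in> carrier (boolean_ring R)" "f \<in> carrier (boolean_ring R)"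
  then have idem: "e \<in> idempotents R" "f \<in> idempotents R" by (simp_all add: boolean_ring_def)
  note c = idem[THEN idempotent_complement(1)]
  have prod: "x \<otimes> y \<in> M \<longleftrightarrow> x \<in> M \<or> y \<in> M"
    if "M \<in> MaxSpec R" "x \<in> carrier R" "y \<in> carrier R" for x y M
  proof -
    interpret primeideal M R using that(1) by (rule MaxSpecD)
    show ?thesis using I_prime I_l_closed I_r_closed that(2,3) by blast
  qed
  show "max_basic_open R (e \<otimes>\<^bsub>boolean_ring R\<^esub> f) =
      max_basic_open R e \<otimes>\<^bsub>clop_ring (max_topology R)\<^esub> max_basic_open R f"
    using prod[OF _ c] by (auto simp: boolean_ring_def clop_ring_def power_set_ring_def basic_open_def)
  \<comment> \<open>The Boolean sum is rewritten as the sum of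
    \<open>e \<otimes> (\<one> \<ominus> f)\<close> and
    \<open>f \<otimes> (\<one> \<ominus> e)\<close>, the algebraic counterparts of the two set
    differences.\<close>
  define s where "s = e \<oplus> f \<ominus> [(2::nat)] \<cdot> (e \<otimes> f)"
  have s: "s = e \<otimes> (\<one> \<ominus> f) \<oplus> f \<otimes> (\<one> \<ominus> e)"
  proof -
    have "[(2::nat)] \<cdot> (e \<otimes> f) = e \<otimes> f \<oplus> e \<otimes> f"
      using c by (simp add: numeral_2_eq_2)
    then show ?thesis unfolding s_def using c by algebra
  qed
  \<comment> \<open>At each maximal ideal at least one of the two summands belongs to
    \<open>M\<close>, so the other one alone decides whether \<open>s\<close> does.\<close>
  have sum: "s \<in> M \<longleftrightarrow> (e \<in> M \<longleftrightarrow> f \<in> M)" if M: "M \<in> MaxSpec R" for M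
  proof -
    interpret primeideal M R using M by (rule MaxSpecD)
    have compl: "\<one> \<ominus> x \<in> M \<longleftrightarrow> x \<notin> M" if "x \<in> idempotents R" for x
      using complement_mem_iff[OF _ _ M] idempotent_complement[OF that] by simp
    have cc: "\<one> \<ominus> e \<in> carrier R" "\<one> \<ominus> f \<in> carrier R" using c by simp_all
    have pq: "e \<otimes> (\<one> \<ominus> f) \<in> M \<longleftrightarrow> e \<in> M \<or> f \<notin> M" "f \<otimes> (\<one> \<ominus> e) \<in> M \<longleftrightarrow> f \<in> M \<or> e \<notin> M"
      using prod[OF M c(1) cc(2)] prod[OF M c(2) cc(1)] compl[OF idem(1)] compl[OF idem(2)]
      by simp_all
    have add: "x \<oplus> y \<in> M \<longleftrightarrow> y \<in> M" if "x \<in> M" "y \<in> carrier R" for x y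
    proof
      assume "x \<oplus> y \<in> M"
      then have "\<ominus> x \<oplus> (x \<oplus> y) \<in> M" using that(1) by simp
      then show "y \<in> M" using that Icarr by (simp add: r_neg1)
    qed (use that in simp)
    show ?thesis
    proof (cases "e \<otimes> (\<one> \<ominus> f) \<in> M")
      case True
      then show ?thesis using add[OF True] pq c cc s by auto
    next
      case False
      then have "f \<otimes> (\<one> \<ominus> e) \<in> M" using pq by blast
      from add[OF this, of "e \<otimes> (\<one> \<ominus> f)"] False show ?thesis
        using pq c cc s by (simp add: a_comm)
    qed
  qed
  have "max_basic_open R s = sym_diff (max_basic_open R e) (max_basic_open R f)"
    unfolding set_eq_iff Un_iff Diff_iff mem_max_basic_open using sum by blast
  then show "max_basic_open R (e \<oplus>\<^bsub>boolean_ring R\<^esub> f) =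
      max_basic_open R e \<oplus>\<^bsub>clop_ring (max_topology R)\<^esub> max_basic_open R f"
    by (simp add: boolean_ring_def clop_ring_def power_set_ring_def s_def)
qed

text \<open>Equal sets put \<open>e \<ominus> f\<close> into the Jacobson radical, but this
  difference need not be idempotent. Its multiple \<open>e \<otimes> (\<one> \<ominus> f)\<close>
  is, so it vanishes and \<open>e = e \<otimes> f\<close>; exchanging the roles gives
  \<open>e = f\<close>.\<close>

lemma (in cring) inj_on_max_basic_open: "inj_on (max_basic_open R) (idempotents R)"
proof -
  have *: "e = e \<otimes> f"
    if idem: "e \<in> idempotents R" "f \<in> idempotents R"
      and eq: "max_basic_open R e = max_basic_open R f" for e f
  proof -
    note c = idem[THEN idempotent_complement(1)]
    have ee: "e \<otimes> e = e" and ff: "f \<otimes> f = f" using idem by (auto simp: idempotents_def)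
    have g: "e \<otimes> (\<one> \<ominus> f) = e \<otimes> (e \<ominus> f)"
    proof -
      have "e \<otimes> (e \<ominus> f) = e \<otimes> e \<ominus> e \<otimes> f" using c by algebra
      also have "\<dots> = e \<otimes> (\<one> \<ominus> f)" unfolding ee using c by algebra
      finally show ?thesis ..
    qed
    have "e \<ominus> f \<in> jacobson_radical R"
      using max_basic_open_eq_iff eq c idem[THEN idempotent_complement_jacobson_radical] by blast
    then have "e \<otimes> (\<one> \<ominus> f) \<in> jacobson_radical R"
      unfolding g using ideal.I_l_closed[OF ideal_jacobson_radical] c by blast
    moreover have "e \<otimes> (\<one> \<ominus> f) \<in> idempotents R"
    proof -
      have "e \<otimes> (\<one> \<ominus> f) \<otimes> (e \<otimes> (\<one> \<ominus> f)) = (e \<otimes> e) \<otimes> (\<one> \<ominus> f \<ominus> f \<oplus> f \<otimes> f)"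
        using c by algebra
      also have "\<dots> = e \<otimes> (\<one> \<ominus> f)" unfolding ee ff using c by algebra
      finally show ?thesis using c by (simp add: idempotents_def)
    qed
    ultimately have "e \<otimes> (\<one> \<ominus> f) = \<zero>" by (intro idempotent_in_jacobson_radical)
    moreover have "e = e \<otimes> (\<one> \<ominus> f) \<oplus> e \<otimes> f" using c by algebra
    ultimately show ?thesis using c by simp
  qed
  show ?thesis
  proof (rule inj_onI)
    fix e f assume ef: "e \<in> idempotents R" "f \<in> idempotents R"
      and eq: "max_basic_open R e = max_basic_open R f"
    have "e = e \<otimes> f" using *[OF ef eq] .
    also have "\<dots> = f \<otimes> e" using ef by (simp add: m_comm idempotent_complement(1))
    also have "\<dots> = f" using *[OF ef(2,1) eq[symmetric]] by simp
    finally show "e = f" .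
  qed
qed

section \<open>Lifting idempotents and surjectivity\<close>

text \<open>Either side says that each \<open>a\<close> with
  \<open>a \<otimes> (\<one> \<ominus> a)\<close> in the radical is congruent to an idempotent
  modulo the radical: such \<open>a\<close> represent both the idempotent cosets and the clopen
  sets, and congruence means equality for both.\<close>

lemma (in cring) lifting_jacobson_radical_iff_surj:
  "lifting_ideal (jacobson_radical R) R \<longleftrightarrow>
    carrier (clop_ring (max_topology R)) \<subseteq> max_basic_open R ` idempotents R"
proof
  note J = ideal_jacobson_radical
  assume lift: "lifting_ideal (jacobson_radical R) R"
  show "carrier (clop_ring (max_topology R)) \<subseteq> max_basic_open R ` idempotents R"
  proof
    fix U assume "U \<in> carrier (clop_ring (max_topology R))"
    then obtain a where a: "a \<in> carrier R" "a \<otimes> (\<one> \<ominus> a) \<in> jacobson_radical R"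
      and U: "U = max_basic_open R a"
      by (rule clopen_eq_max_basic_open)
    then obtain e where e: "e \<in> idempotents R"
      "jacobson_radical R +> a = jacobson_radical R +> e"
      using lift idempotents_Quot_iff[OF J a(1)] by (auto simp: lifting_ideal_def)
    have "a \<ominus> e \<in> jacobson_radical R"
      using quotient_eq_iff_same_a_r_cos[OF J a(1)] e idempotent_complement(1) by blast
    then have "U = max_basic_open R e"
      unfolding U using max_basic_open_eq_iff[OF a] e(1) idempotent_complement(1)
        idempotent_complement_jacobson_radical by blast
    with e(1) show "U \<in> max_basic_open R ` idempotents R" by blast
  qed
next
  note J = ideal_jacobson_radical
  assume surj: "carrier (clop_ring (max_topology R)) \<subseteq> max_basic_open R ` idempotents R"
  show "lifting_ideal (jacobson_radical R) R"
    unfolding lifting_ideal_def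
  proof (intro conjI J ballI)
    fix x assume x: "x \<in> idempotents (R Quot jacobson_radical R)"
    then obtain f where f: "f \<in> carrier R" "x = jacobson_radical R +> f"
      by (auto simp: idempotents_def FactRing_def A_RCOSETS_def' a_r_coset_def)
    then have fJ: "f \<otimes> (\<one> \<ominus> f) \<in> jacobson_radical R"
      using x idempotents_Quot_iff[OF J] by simp
    then obtain e where e: "e \<in> idempotents R" "max_basic_open R f = max_basic_open R e"
      using surj max_basic_open_clopen[OF f(1)] by blast
    then have "f \<ominus> e \<in> jacobson_radical R"
      using max_basic_open_eq_iff[OF f(1) fJ] idempotent_complement(1)
        idempotent_complement_jacobson_radical by blast
    then show "\<exists>e\<in>idempotents R. x = jacobson_radical R +> e"
      using quotient_eq_iff_same_a_r_cos[OF J f(1)] e(1) f(2) idempotent_complement(1) by blast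
  qed
qed

theorem corollary3p17:
  fixes R :: "('a, 'm) ring_scheme"
  assumes "cring R"
  shows "lifting_ideal (jacobson_radical R) R \<longleftrightarrow>
    (\<lambda>e. MaxSpec R \<inter> basic_open R e) \<in> ring_iso (boolean_ring R) (clop_ring (max_topology R))"
proof -
  interpret cring R by fact
  have c: "carrier (boolean_ring R) = idempotents R" by (simp add: boolean_ring_def)
  \<comment> \<open>This is the inclusion that, joined with surjectivity, gives the equality of
    image and carrier required for a bijection.\<close>
  have "max_basic_open R ` idempotents R \<subseteq> carrier (clop_ring (max_topology R))"
    using ring_hom_closed[OF max_basic_open_hom] c by blast
  then show ?thesis
    unfolding lifting_jacobson_radical_iff_surj ring_iso_def bij_betw_def c
    using max_basic_open_hom inj_on_max_basic_open by auto
qed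

end
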